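(* Let $G=(V,E)$ be a connected cograph. Then $\mu(G)\ge |V|-2$, and a mutual-visibility set of $G$ of maximum cardinality can be computed in polynomial time (that is, there is a polynomial-time algorithm that, given a connected cograph $G$, outputs a mutual-visibility set of $G$ of size $\mu(G)$).
   Context: Graphs are finite, simple, loopless, undirected and unweighted. $N_G(v)$ denotes the set of neighbors of $v$ and $N_G[v]=N_G(v)\cup\{v\}$. Two distinct vertices $u,v$ are true twins if $uv\in E$ and $N_G[u]=N_G[v]$, and false twins if $uv\notin E$ and $N_G(u)=N_G(v)$; twins are true or false twins. Splitting is the operation of extending a graph by adding a new vertex which has a twin in the obtained graph. A connected cograph is a connected graph obtained from $K_1$ by a (possibly empty) sequence of splittings. For a graph $G=(V,E)$ and $P\subseteq V$, two vertices $u,v\in P$ are mutually visible if there is a shortest $(u,v)$-path in $G$ containing no vertex of $P$ other than $u$ and $v$. $P$ is a mutual-visibility set of $G$ if its vertices are pairwise mutually visible. The mutual-visibility number $\mu(G)$ is the maximum cardinality of a mutual-visibility set of $G$. *)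

theory Defs
  imports "Graph_Theory.Digraph_Component_Vwalk"
begin

section \<open>Connected cographs\<close>

text \<open>
  A finite simple undirected graph is a \<^locale>\<open>pair_graph\<close>: finite, loop-free, and with a
  symmetric arc relation, so that an edge between \<open>u\<close> and \<open>v\<close> is the pair of arcs
  \<open>(u, v)\<close> and \<open>(v, u)\<close>.
\<close>

definition nbhd :: "'a pair_pre_digraph \<Rightarrow> 'a \<Rightarrow> 'a set" where
  "nbhd G v = {u. (v, u) \<in> parcs G}"

definition closed_nbhd :: "'a pair_pre_digraph \<Rightarrow> 'a \<Rightarrow> 'a set" where
  "closed_nbhd G v = insert v (nbhd G v)"

definition true_twins :: "'a pair_pre_digraph \<Rightarrow> 'a \<Rightarrow> 'a \<Rightarrow> bool" where
  "true_twins G u v \<longleftrightarrow> u \<in> pverts G \<and> v \<in> pverts G \<and> u \<noteq> v \<and>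
     (u, v) \<in> parcs G \<and> closed_nbhd G u = closed_nbhd G v"

definition false_twins :: "'a pair_pre_digraph \<Rightarrow> 'a \<Rightarrow> 'a \<Rightarrow> bool" where
  "false_twins G u v \<longleftrightarrow> u \<in> pverts G \<and> v \<in> pverts G \<and> u \<noteq> v \<and>
     (u, v) \<notin> parcs G \<and> nbhd G u = nbhd G v"

definition twins :: "'a pair_pre_digraph \<Rightarrow> 'a \<Rightarrow> 'a \<Rightarrow> bool" where
  "twins G u v \<longleftrightarrow> true_twins G u v \<or> false_twins G u v"

text \<open>\<open>G\<close> is obtained from \<open>H\<close> by one splitting.\<close>

definition splitting :: "'a pair_pre_digraph \<Rightarrow> 'a pair_pre_digraph \<Rightarrow> bool" where
  "splitting H G \<longleftrightarrow> pair_graph G \<and> induced_subgraph (with_proj H) (with_proj G) \<and>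
     (\<exists>v. v \<notin> pverts H \<and> pverts G = insert v (pverts H) \<and> (\<exists>u. twins G u v))"

text \<open>
  Only the final graph is required to be connected; the intermediate graphs are arbitrary.
\<close>

definition connected_cograph :: "'a pair_pre_digraph \<Rightarrow> bool" where
  "connected_cograph G \<longleftrightarrow> Digraph_Component.connected (with_proj G) \<and>
     (\<exists>v. splitting\<^sup>*\<^sup>* \<lparr>pverts = {v}, parcs = {}\<rparr> G)"


section \<open>Mutual visibility\<close>

definition shortest_path :: "'a pair_pre_digraph \<Rightarrow> 'a \<Rightarrow> 'a vwalk \<Rightarrow> 'a \<Rightarrow> bool" where
  "shortest_path G u p v \<longleftrightarrow> vpath p (with_proj G) \<and> hd p = u \<and> last p = v \<and>
     (\<forall>q. vpath q (with_proj G) \<and> hd q = u \<and> last q = v \<longrightarrow> vwalk_length p \<le> vwalk_length q)"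

definition mutually_visible :: "'a pair_pre_digraph \<Rightarrow> 'a set \<Rightarrow> 'a \<Rightarrow> 'a \<Rightarrow> bool" where
  "mutually_visible G P u v \<longleftrightarrow> (\<exists>p. shortest_path G u p v \<and> set p \<inter> P \<subseteq> {u, v})"

definition mutual_visibility_set :: "'a pair_pre_digraph \<Rightarrow> 'a set \<Rightarrow> bool" where
  "mutual_visibility_set G P \<longleftrightarrow>
     P \<subseteq> pverts G \<and> (\<forall>u \<in> P. \<forall>v \<in> P. u \<noteq> v \<longrightarrow> mutually_visible G P u v)"

definition mutual_visibility_number :: "'a pair_pre_digraph \<Rightarrow> nat" where
  "mutual_visibility_number G = Max (card ` {P. mutual_visibility_set G P})"


section \<open>Polynomial-time algorithms\<close>

text \<open>
  The machine model is the random access machine of Cook and Reckhow with unit cost, whose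
  programs are written with structured control flow instead of jumps. It has registers and a
  memory, both indexed by natural numbers and holding natural numbers; a program refers only to
  the finitely many registers that occur in it, and to the memory by indirect addressing. The
  arithmetic instructions are addition and truncated subtraction. Since there is no
  multiplication, the length of the binary representation of the stored numbers grows by at
  most one bit per step, and so polynomial time on this machine and on Turing machines
  coincide.
\<close>

type_synonym ram_state = "(nat \<Rightarrow> nat) \<times> (nat \<Rightarrow> nat)"

datatype ram_prog =
    Skip
  | Const nat nat
  | Add nat nat nat
  | Sub nat nat nat
  | Load nat nat
  | Store nat nat
  | Seq ram_prog ram_prog
  | IfPos nat ram_prog ram_prog
  | WhilePos nat ram_prog

text \<open>
  \<open>exec c s t s'\<close>: started in state \<open>s\<close>, the program \<open>c\<close> halts in state \<open>s'\<close> after exactly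
  \<open>t\<close> steps. Executing an instruction and evaluating the test of a conditional or of a loop
  take one step each.
\<close>

inductive exec :: "ram_prog \<Rightarrow> ram_state \<Rightarrow> nat \<Rightarrow> ram_state \<Rightarrow> bool" where
  Skip: "exec Skip s 1 s"
| Const: "exec (Const r n) (R, M) 1 (R(r := n), M)"
| Add: "exec (Add r a b) (R, M) 1 (R(r := R a + R b), M)"
| Sub: "exec (Sub r a b) (R, M) 1 (R(r := R a - R b), M)"
| Load: "exec (Load r a) (R, M) 1 (R(r := M (R a)), M)"
| Store: "exec (Store a r) (R, M) 1 (R, M(R a := R r))"
| Seq: "exec c1 s t1 s' \<Longrightarrow> exec c2 s' t2 s'' \<Longrightarrow> exec (Seq c1 c2) s (t1 + t2) s''"
| IfTrue: "fst s r > 0 \<Longrightarrow> exec c1 s t s' \<Longrightarrow> exec (IfPos r c1 c2) s (1 + t) s'"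
| IfFalse: "fst s r = 0 \<Longrightarrow> exec c2 s t s' \<Longrightarrow> exec (IfPos r c1 c2) s (1 + t) s'"
| WhileFalse: "fst s r = 0 \<Longrightarrow> exec (WhilePos r c) s 1 s"
| WhileTrue: "fst s r > 0 \<Longrightarrow> exec c s t1 s' \<Longrightarrow> exec (WhilePos r c) s' t2 s'' \<Longrightarrow>
    exec (WhilePos r c) s (1 + t1 + t2) s''"

inductive_cases exec_elims:
  "exec Skip s t s'"
  "exec (Const r n) s t s'"
  "exec (Add r a b) s t s'"
  "exec (Sub r a b) s t s'"
  "exec (Load r a) s t s'"
  "exec (Store a r) s t s'"
  "exec (Seq c1 c2) s t s'"
  "exec (IfPos r c1 c2) s t s'"

inductive_cases exec_WhileE: "exec (WhilePos r c) s t s'"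

lemma exec_deterministic:
  assumes "exec c s t s'" and "exec c s u s''"
  shows "t = u \<and> s' = s''"
  using assms
proof (induction arbitrary: u s'' rule: exec.induct)
  case (Seq c1 s t1 s' c2 t2 s3)
  from Seq.prems obtain u1 u2 v where
    *: "u = u1 + u2" "exec c1 s u1 v" "exec c2 v u2 s''"
    by (rule exec_elims(7)) blast
  from Seq.IH(1)[OF *(2)] Seq.IH(2) * show ?case by simp
next
  case (IfTrue s r c1 t s' c2)
  from IfTrue.prems IfTrue.hyps(1) obtain u1 where
    *: "u = 1 + u1" "exec c1 s u1 s''"
    by (elim exec_elims(8)) simp_all
  from IfTrue.IH[OF *(2)] * show ?case by simp
next
  case (IfFalse s r c2 t s' c1)
  from IfFalse.prems IfFalse.hyps(1) obtain u1 where
    *: "u = 1 + u1" "exec c2 s u1 s''"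
    by (elim exec_elims(8)) simp_all
  from IfFalse.IH[OF *(2)] * show ?case by simp
next
  case (WhileFalse s r c)
  from WhileFalse.prems show ?case
    by (rule exec_WhileE) (use WhileFalse.hyps in simp_all)
next
  case (WhileTrue s r c t1 s' t2 s3)
  from WhileTrue.prems obtain u1 u2 v where
    *: "u = 1 + u1 + u2" "exec c s u1 v" "exec (WhilePos r c) v u2 s''"
    by (rule exec_WhileE) (use WhileTrue.hyps in simp_all)
  from WhileTrue.IH(1)[OF *(2)] WhileTrue.IH(2) * show ?case by simp
qed (erule exec_elims(1-6), simp)+

text \<open>
  The input is a bit string, written to the initial cells of the memory, with its length in
  register \<open>0\<close>; everything else is initially zero. The output bit string is returned in the same
  way.
\<close>

definition input_state :: "bool list \<Rightarrow> ram_state" where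
  "input_state x =
     ((\<lambda>_. 0)(0 := length x), (\<lambda>i. if i < length x then of_bool (x ! i) else 0))"

definition is_output :: "ram_state \<Rightarrow> bool list \<Rightarrow> bool" where
  "is_output s y \<longleftrightarrow> fst s 0 = length y \<and> (\<forall>i < length y. snd s i = of_bool (y ! i))"

text \<open>
  The search problem with set of instances \<open>I\<close>, input encoding \<open>enc\<close> and solution relation
  \<open>sol\<close> is solved by one program, in time polynomial in the length of the input. Inputs that do
  not encode an element of \<open>I\<close> are excluded by promise.
\<close>

definition poly_time_solvable ::
    "'i set \<Rightarrow> ('i \<Rightarrow> bool list) \<Rightarrow> ('i \<Rightarrow> bool list \<Rightarrow> bool) \<Rightarrow> bool" where
  "poly_time_solvable I enc sol \<longleftrightarrow>
     (\<exists>c a d. \<forall>x \<in> I. \<exists>t s y. exec c (input_state (enc x)) t s \<and>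
        t \<le> a * length (enc x) ^ d + a \<and> is_output s y \<and> sol x y)"

text \<open>
  Graphs with vertex set \<open>{..<n}\<close> are encoded by their adjacency matrix in row-major order, sets
  of vertices by their characteristic vector.
\<close>

definition adjacency_matrix :: "nat pair_pre_digraph \<Rightarrow> bool list" where
  "adjacency_matrix G =
     [(i, j) \<in> parcs G. i \<leftarrow> [0..<card (pverts G)], j \<leftarrow> [0..<card (pverts G)]]"

definition characteristic_vector :: "nat pair_pre_digraph \<Rightarrow> nat set \<Rightarrow> bool list" where
  "characteristic_vector G P = map (\<lambda>i. i \<in> P) [0..<card (pverts G)]"

end

theory Submission
  imports Defs
begin

text \<open>
  A connected cograph with at least two vertices is a join of two graphs \<open>A\<close> and \<open>B\<close>: by induction
  on the splittings, every cograph with at least two vertices is a join or a disjoint union, since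
  a new vertex can be put on the side of its twin. Hence nonadjacent vertices have a common
  neighbour, and \<open>P\<close> is a mutual-visibility set iff any two nonadjacent vertices of \<open>P\<close> have a
  common neighbour outside \<open>P\<close>. Removing one vertex of \<open>A\<close> and one of \<open>B\<close> leaves such a set.

  A maximum set is therefore found among the sets \<open>V - {a, b}\<close>. The algorithm tries all pairs
  \<open>(a, b)\<close> with \<open>a, b \<le> n\<close> in decreasing lexicographic order, where \<open>n\<close> stands for ``no vertex'',
  so that \<open>V\<close> comes first and the sets \<open>V - {b}\<close> precede the sets of size \<open>|V| - 2\<close>; the first
  success has maximum cardinality.
\<close>

section \<open>Mutual visibility in connected cographs\<close>

text \<open>The flag \<open>c\<close> treats both cases at once: \<open>True\<close> gives a join,
  \<open>False\<close> a disjoint union.\<close>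

definition uniform_cut :: "'a pair_pre_digraph \<Rightarrow> 'a set \<Rightarrow> 'a set \<Rightarrow> bool \<Rightarrow> bool" where
  "uniform_cut G A B c \<longleftrightarrow> A \<noteq> {} \<and> B \<noteq> {} \<and> A \<inter> B = {} \<and> A \<union> B = pverts G \<and>
     (\<forall>x \<in> A. \<forall>y \<in> B. ((x, y) \<in> parcs G \<longleftrightarrow> c) \<and> ((y, x) \<in> parcs G \<longleftrightarrow> c))"

lemma uniform_cut_commute: "uniform_cut G A B c \<Longrightarrow> uniform_cut G B A c"
  unfolding uniform_cut_def by blast

lemma (in pair_graph) parcs_sym: "(u, v) \<in> parcs G \<longleftrightarrow> (v, u) \<in> parcs G"
  using pair_sym_arcs by (auto simp: symmetric_def elim: symE)

lemma (in pair_graph) twins_arc_iff: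
  assumes "twins G u v" and "w \<noteq> u" and "w \<noteq> v"
  shows "(w, u) \<in> parcs G \<longleftrightarrow> (w, v) \<in> parcs G"
  using assms parcs_sym
  unfolding twins_def true_twins_def false_twins_def closed_nbhd_def nbhd_def by blast

text \<open>The new vertex goes to the side of its twin: no vertex of the other side distinguishes
  the twins, so the cut stays uniform with the same \<open>c\<close>.\<close>

lemma uniform_cut_splitting:
  assumes "splitting H G" and "uniform_cut H A B c"
  shows "\<exists>A B. uniform_cut G A B c"
proof -
  from assms(1) interpret pair_graph G by (simp add: splitting_def)
  from assms(1) obtain u v where v: "v \<notin> pverts H" "pverts G = insert v (pverts H)"
    and tw: "twins G u v" and ind: "induced_subgraph (with_proj H) (with_proj G)"
    unfolding splitting_def by blast
  have arcs: "parcs H = {e \<in> parcs G. fst e \<in> pverts H \<and> snd e \<in> pverts H}"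
    using ind unfolding induced_subgraph_def by simp
  have "u \<in> pverts H"
    using tw v unfolding twins_def true_twins_def false_twins_def by auto
  \<comment> \<open>The twin lies on one of the two sides; the names are swapped if necessary to
    make it \<open>A\<close>.\<close>
  then obtain A B where uA: "u \<in> A" and cut: "uniform_cut H A B c"
    using assms(2) uniform_cut_commute[OF assms(2)] that[of A B] that[of B A]
    by (auto simp: uniform_cut_def[of H A B])
  have "((x, y) \<in> parcs G \<longleftrightarrow> c) \<and> ((y, x) \<in> parcs G \<longleftrightarrow> c)"
    if "x \<in> insert v A" "y \<in> B" for x y
  proof -
    have AB: "(y, z) \<in> parcs G \<longleftrightarrow> c" if "z \<in> A" for z
    proof -
      have "(y, z) \<in> parcs H \<longleftrightarrow> c" "y \<in> pverts H" "z \<in> pverts H"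
        using cut that \<open>y \<in> B\<close> unfolding uniform_cut_def by blast+
      then show ?thesis using arcs by simp
    qed
    have "y \<noteq> u" "y \<noteq> v"
      using cut uA that(2) v unfolding uniform_cut_def by auto
    then have "(y, x) \<in> parcs G \<longleftrightarrow> c"
      using that(1) AB AB[OF uA] twins_arc_iff[OF tw] by auto
    then show ?thesis using parcs_sym by blast
  qed
  then have "uniform_cut G (insert v A) B c"
    using cut v unfolding uniform_cut_def by auto
  then show ?thesis by blast
qed

text \<open>The one-vertex graph has no cut; the first splitting creates one and all later
  splittings preserve it.\<close>

lemma splittings_uniform_cut:
  assumes "splitting\<^sup>*\<^sup>* \<lparr>pverts = {v}, parcs = {}\<rparr> G"
  shows "pair_graph G \<and> (pverts G = {v} \<or> (\<exists>A B c. uniform_cut G A B c))"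
  using assms
proof (induction rule: rtranclp_induct)
  case base
  show ?case
    by (simp, unfold_locales) (auto simp: arc_to_ends_def symmetric_def sym_def)
next
  case (step H G)
  then interpret pair_graph G by (simp add: splitting_def)
  \<comment> \<open>On two vertices the singletons form a cut, and \<open>c\<close> records whether
    they are adjacent.\<close>
  have "\<exists>A B c. uniform_cut G A B c" if H: "pverts H = {v}"
  proof -
    obtain w where "w \<noteq> v" "pverts G = {v, w}"
      using step.hyps(2) H unfolding splitting_def by (auto simp: insert_commute)
    then have "uniform_cut G {v} {w} ((v, w) \<in> parcs G)"
      using parcs_sym unfolding uniform_cut_def by auto
    then show ?thesis by blast
  qed
  then show ?case
    using step.IH uniform_cut_splitting[OF step.hyps(2)] pair_graph by blast
qed

text \<open>Without arcs between the sides, everything reachable from \<open>A\<close> stays in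
  \<open>A\<close>; so connectedness rules out a disjoint union.\<close>

lemma (in pair_graph) connected_uniform_cut:
  assumes "Digraph_Component.connected (with_proj G)" and cut: "uniform_cut G A B c"
  shows c
proof (rule ccontr)
  assume "\<not> c"
  obtain x y where xy: "x \<in> A" "y \<in> B" using cut unfolding uniform_cut_def by blast
  have "x \<rightarrow>\<^sup>*\<^bsub>with_proj (mk_symmetric (with_proj G))\<^esub> y"
    using assms(1) xy cut
    unfolding Digraph_Component.connected_def strongly_connected_def uniform_cut_def by auto
  then have "x \<rightarrow>\<^sup>*\<^bsub>with_proj G\<^esub> y" by (simp add: reachable_mk_symmetric_eq sym_arcs)
  then have "y \<in> A"
  proof (induction rule: reachable_induct)
    case (step a b)
    then have "b \<in> A \<union> B" using cut in_arcsD2 unfolding uniform_cut_def by auto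
    then show ?case using step \<open>\<not> c\<close> cut unfolding uniform_cut_def by auto
  qed (rule xy)
  then show False using xy cut unfolding uniform_cut_def by blast
qed

locale cograph = pair_graph +
  assumes conn_cograph: "connected_cograph G"
begin

lemma join:
  obtains (singleton) v where "pverts G = {v}"
  | (join) A B where "uniform_cut G A B True"
proof -
  from conn_cograph obtain v where "splitting\<^sup>*\<^sup>* \<lparr>pverts = {v}, parcs = {}\<rparr> G"
    unfolding connected_cograph_def by blast
  from splittings_uniform_cut[OF this] show thesis
    using that connected_uniform_cut conn_cograph unfolding connected_cograph_def by metis
qed

text \<open>Distinct nonadjacent vertices lie on the same side of the join, and every vertex of the
  other side is adjacent to both.\<close>

lemma common_neighbour:
  assumes "u \<in> pverts G" "v \<in> pverts G" "u \<noteq> v" "(u, v) \<notin> parcs G"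
  shows "\<exists>w. (u, w) \<in> parcs G \<and> (w, v) \<in> parcs G"
proof (cases rule: join)
  case (singleton v)
  then show ?thesis using assms by auto
next
  case (join A B)
  then show ?thesis using assms unfolding uniform_cut_def by (metis Un_iff all_not_in_conv)
qed

section \<open>Shortest paths and visibility\<close>

text \<open>Since \<open>length\<close> counts vertices, the bounds 2 and 3 stand for distances 1
  and 2.\<close>

lemma vpath_length_ge:
  assumes "vpath p (with_proj G)" "hd p = u" "last p = v" "u \<noteq> v"
  shows "length p \<ge> 2 \<and> ((u, v) \<notin> parcs G \<longrightarrow> length p \<ge> 3)"
proof (cases p rule: vwalk_arcs.cases)
  case (3 x y xs)
  then show ?thesis using assms by (cases xs) (auto simp: vpath_def vwalk_def)
qed (use assms in \<open>auto simp: vpath_def vwalk_def\<close>)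

lemma arc_if_short:
  assumes "vpath p (with_proj G)" "hd p = u" "last p = v" "u \<noteq> v" "length p \<le> 3"
    and "(u, v) \<notin> parcs G"
  obtains w where "p = [u, w, v]"
proof -
  have "length p = Suc (Suc (Suc 0))" using vpath_length_ge[OF assms(1-4)] assms(5,6) by simp
  then show thesis using assms(2,3) that by (auto simp: length_Suc_conv)
qed

text \<open>Distances are at most two. Between distinct nonadjacent vertices the shortest paths are
  the paths with a single inner vertex, and visibility asks for such a vertex outside
  \<open>P\<close>.\<close>

lemma mutually_visible_iff:
  assumes uv: "u \<in> P" "v \<in> P" "u \<noteq> v" and P: "P \<subseteq> pverts G"
  shows "mutually_visible G P u v \<longleftrightarrow>
    (u, v) \<in> parcs G \<or> (\<exists>w. w \<notin> P \<and> (u, w) \<in> parcs G \<and> (w, v) \<in> parcs G)"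
proof
  assume "mutually_visible G P u v"
  then obtain p where p: "shortest_path G u p v" "set p \<inter> P \<subseteq> {u, v}"
    unfolding mutually_visible_def by blast
  have vp: "vpath p (with_proj G)" "hd p = u" "last p = v"
    using p(1) unfolding shortest_path_def by auto
  show "(u, v) \<in> parcs G \<or> (\<exists>w. w \<notin> P \<and> (u, w) \<in> parcs G \<and> (w, v) \<in> parcs G)"
  proof (rule disjCI)
    assume no: "\<not> (\<exists>w. w \<notin> P \<and> (u, w) \<in> parcs G \<and> (w, v) \<in> parcs G)"
    show "(u, v) \<in> parcs G"
    proof (rule ccontr)
      assume na: "(u, v) \<notin> parcs G"
      \<comment> \<open>This \<open>w\<close> may lie in \<open>P\<close>; it only bounds the length
        of \<open>p\<close>, whose own middle vertex is the one outside \<open>P\<close>.\<close>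
      then obtain w where w: "(u, w) \<in> parcs G" "(w, v) \<in> parcs G"
        using common_neighbour uv P by blast
      then have "vpath [u, w, v] (with_proj G)"
        using uv P in_arcsD2 no_loops' unfolding vpath_def vwalk_def by auto
      then have "vwalk_length p \<le> vwalk_length [u, w, v]"
        using p(1) unfolding shortest_path_def by (metis last.simps list.distinct(1) list.sel(1))
      then have "length p \<le> 3" by simp
      then obtain x where x: "p = [u, x, v]"
        using arc_if_short[OF vp uv(3)] na by blast
      then have "(u, x) \<in> parcs G" "(x, v) \<in> parcs G" "x \<notin> P"
        using vp(1) p(2) unfolding vpath_def vwalk_def by auto
      then show False using no by blast
    qed
  qed
next
  have walk: "length q \<ge> 2 \<and> ((u, v) \<notin> parcs G \<longrightarrow> length q \<ge> 3)"
    if "vpath q (with_proj G)" "hd q = u" "last q = v" for q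
    using vpath_length_ge[OF that uv(3)] by simp
  assume "(u, v) \<in> parcs G \<or> (\<exists>w. w \<notin> P \<and> (u, w) \<in> parcs G \<and> (w, v) \<in> parcs G)"
  then consider "(u, v) \<in> parcs G"
    | w where "(u, v) \<notin> parcs G" "w \<notin> P" "(u, w) \<in> parcs G" "(w, v) \<in> parcs G"
    by blast
  then show "mutually_visible G P u v"
  proof cases
    case 1
    then have "shortest_path G u [u, v] v"
      using uv P walk unfolding shortest_path_def
      by (fastforce simp: vpath_def vwalk_def le_diff_conv)
    then show ?thesis unfolding mutually_visible_def by fastforce
  next
    case 2
    then have "vpath [u, w, v] (with_proj G)"
      using uv P in_arcsD2 unfolding vpath_def vwalk_def by auto
    then have "shortest_path G u [u, w, v] v"
      using walk 2(1) unfolding shortest_path_def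
      by (fastforce simp: vpath_def vwalk_def le_diff_conv)
    then show ?thesis unfolding mutually_visible_def using 2 by (intro exI[of _ "[u, w, v]"]) auto
  qed
qed

text \<open>A common neighbour outside the set is a vertex, hence \<open>a\<close> or
  \<open>b\<close>. The equivalence also covers indices outside the graph, which lets the search use
  \<open>n\<close> for a missing vertex.\<close>

lemma mutual_visibility_set_Diff_iff:
  "mutual_visibility_set G (pverts G - {a, b}) \<longleftrightarrow>
    (\<forall>u \<in> pverts G - {a, b}. \<forall>v \<in> pverts G - {a, b}. u = v \<or> (u, v) \<in> parcs G \<or>
       (a, u) \<in> parcs G \<and> (a, v) \<in> parcs G \<or> (b, u) \<in> parcs G \<and> (b, v) \<in> parcs G)"
proof -
  let ?P = "pverts G - {a, b}"
  have common: "(\<exists>w. w \<notin> ?P \<and> (u, w) \<in> parcs G \<and> (w, v) \<in> parcs G) \<longleftrightarrow>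
      (a, u) \<in> parcs G \<and> (a, v) \<in> parcs G \<or> (b, u) \<in> parcs G \<and> (b, v) \<in> parcs G"
    (is "?L \<longleftrightarrow> ?R") for u v
  proof
    assume ?L
    then obtain w where "w \<notin> ?P" "(u, w) \<in> parcs G" "(w, v) \<in> parcs G" by blast
    then show ?R using parcs_sym[of u w] in_arcsD2[of u w] by auto
  qed (use parcs_sym in auto)
  have vis: "mutually_visible G ?P u v \<longleftrightarrow> (u, v) \<in> parcs G \<or>
      (a, u) \<in> parcs G \<and> (a, v) \<in> parcs G \<or> (b, u) \<in> parcs G \<and> (b, v) \<in> parcs G"
    if "u \<in> ?P" "v \<in> ?P" "u \<noteq> v" for u v
    by (simp only: mutually_visible_iff[OF that Diff_subset] common)
  show ?thesis
    unfolding mutual_visibility_set_def using vis by blast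
qed

text \<open>Nonadjacent vertices on one side of the join see each other through the vertex removed
  from the other side. In a one-vertex graph, \<open>a = b\<close> leaves the empty set.\<close>

lemma ex_mutual_visibility_set_Diff:
  "\<exists>a \<in> pverts G. \<exists>b \<in> pverts G. mutual_visibility_set G (pverts G - {a, b})"
proof (cases rule: join)
  case (singleton v)
  then show ?thesis by (auto simp: mutual_visibility_set_def)
next
  case (join A B)
  then obtain a b where "a \<in> A" "b \<in> B" unfolding uniform_cut_def by blast
  then have "mutual_visibility_set G (pverts G - {a, b})"
    using join unfolding mutual_visibility_set_Diff_iff uniform_cut_def by blast
  moreover have "a \<in> pverts G" "b \<in> pverts G"
    using \<open>a \<in> A\<close> \<open>b \<in> B\<close> join unfolding uniform_cut_def by auto
  ultimately show ?thesis by blast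
qed

section \<open>The mutual-visibility number\<close>

lemma finite_mutual_visibility_sets: "finite {P. mutual_visibility_set G P}"
  by (rule finite_subset[of _ "Pow (pverts G)"])
    (auto simp: mutual_visibility_set_def pair_finite_verts)

lemma card_le_mutual_visibility_number:
  "mutual_visibility_set G P \<Longrightarrow> card P \<le> mutual_visibility_number G"
  unfolding mutual_visibility_number_def using finite_mutual_visibility_sets by (intro Max_ge) auto

lemma mutual_visibility_number_witness:
  obtains P where "mutual_visibility_set G P" "card P = mutual_visibility_number G"
proof -
  have "mutual_visibility_set G {}" by (simp add: mutual_visibility_set_def)
  then have "mutual_visibility_number G \<in> card ` {P. mutual_visibility_set G P}"
    unfolding mutual_visibility_number_def using finite_mutual_visibility_sets
    by (intro Max_in) auto
  then show thesis using that by auto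
qed

lemma card_Diff_pair: "card (pverts G) \<le> card (pverts G - {a, b}) + 2"
proof -
  have "card (pverts G) - card {a, b} \<le> card (pverts G - {a, b})" by (rule diff_card_le_card_Diff) simp
  moreover have "card {a, b} \<le> 2" by (simp add: card_insert_if)
  ultimately show ?thesis by linarith
qed

lemma mutual_visibility_number_ge: "card (pverts G) \<le> mutual_visibility_number G + 2"
proof -
  obtain a b where "mutual_visibility_set G (pverts G - {a, b})"
    using ex_mutual_visibility_set_Diff by blast
  from card_le_mutual_visibility_number[OF this] card_Diff_pair[of a b] show ?thesis by simp
qed

end

lemma connected_cograph_imp_cograph: "connected_cograph G \<Longrightarrow> cograph G"
  using splittings_uniform_cut[of _ G]
  by (auto simp: connected_cograph_def cograph_def cograph_axioms_def)

text \<open>At most two vertices are removed, so a larger \<open>Q\<close> misses at most one. It is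
  then the complement of \<open>{n, n}\<close> or \<open>{n, w}\<close>, and lexicographic
  maximality forces \<open>a = n\<close>, so that at most \<open>b\<close> is removed, and nothing
  at all in the first case.\<close>

lemma first_pair_is_maximum:
  fixes G :: "nat pair_pre_digraph"
  assumes G: "connected_cograph G" "pverts G = {..<n}"
    and ab: "mutual_visibility_set G ({..<n} - {a, b})" "a \<le> n" "b \<le> n"
    and max: "\<And>a' b'. a' \<le> n \<Longrightarrow> b' \<le> n \<Longrightarrow> mutual_visibility_set G ({..<n} - {a', b'}) \<Longrightarrow>
       a' < a \<or> a' = a \<and> b' \<le> b"
  shows "card ({..<n} - {a, b}) = mutual_visibility_number G"
proof (rule antisym)
  interpret cograph G by (rule connected_cograph_imp_cograph) (rule G)
  show "card ({..<n} - {a, b}) \<le> mutual_visibility_number G"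
    using card_le_mutual_visibility_number ab(1) .
  obtain Q where Q: "mutual_visibility_set G Q" "card Q = mutual_visibility_number G"
    by (rule mutual_visibility_number_witness)
  have Qn: "Q \<subseteq> {..<n}" using Q(1) G(2) unfolding mutual_visibility_set_def by simp
  have cardQ: "n = card Q + card ({..<n} - Q)"
    using Qn by (simp add: card_Diff_subset finite_subset card_mono[of "{..<n}" Q, simplified])
  show "mutual_visibility_number G \<le> card ({..<n} - {a, b})"
  proof (rule ccontr)
    assume "\<not> ?thesis"
    then have less: "card ({..<n} - {a, b}) < card Q" using Q by simp
    have "card ({..<n} - Q) \<le> 1"
      using less cardQ card_Diff_pair[of a b] G(2) by simp
    then consider "{..<n} - Q = {}" | w where "{..<n} - Q = {w}"
      by (metis card_1_singletonE card_eq_0_iff finite_Diff finite_lessThan le_antisym less_one not_le)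
    then show False
    proof cases
      case 1
      then have "Q = {..<n} - {n, n}" using Qn by auto
      then have "a = n" "b = n" using max[of n n] Q(1) ab by auto
      then show False using less cardQ by simp
    next
      case 2
      then have "Q = {..<n} - {n, w}" "w < n" using Qn by auto
      then have "a = n" "w \<le> b" using max[of n w] Q(1) ab by auto
      \<comment> \<open>Whether or not \<open>b\<close> is a vertex, \<open>{..<n} - {b}\<close> is
        at least as large as \<open>Q\<close>, which misses exactly \<open>w\<close>.\<close>
      then have "{..<n} - {a, b} = {..<n} - {b}" by auto
      then show False using less cardQ 2
        by (cases "b < n") auto
    qed
  qed
qed


section \<open>Reasoning about random access machines\<close>

text \<open>Total correctness with cost: the postcondition also receives the number of steps, so
  results and time bounds are proved together.\<close>

definition wp :: "ram_prog \<Rightarrow> (nat \<Rightarrow> ram_state \<Rightarrow> bool) \<Rightarrow> ram_state \<Rightarrow> bool" where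
  "wp c Q s \<longleftrightarrow> (\<exists>t s'. exec c s t s' \<and> Q t s')"

lemma wp_mono: "wp c Q s \<Longrightarrow> (\<And>t s'. Q t s' \<Longrightarrow> Q' t s') \<Longrightarrow> wp c Q' s"
  unfolding wp_def by blast

text \<open>Stated as equivalences, so that the simplifier can execute straight-line code
  symbolically.\<close>

lemma wp_atomic:
  "wp Skip Q s \<longleftrightarrow> Q 1 s"
  "wp (Const r n) Q s \<longleftrightarrow> Q 1 ((fst s)(r := n), snd s)"
  "wp (Add r a b) Q s \<longleftrightarrow> Q 1 ((fst s)(r := fst s a + fst s b), snd s)"
  "wp (Sub r a b) Q s \<longleftrightarrow> Q 1 ((fst s)(r := fst s a - fst s b), snd s)"
  "wp (Load r a) Q s \<longleftrightarrow> Q 1 ((fst s)(r := snd s (fst s a)), snd s)"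
  "wp (Store a r) Q s \<longleftrightarrow> Q 1 (fst s, (snd s)(fst s a := fst s r))"
  unfolding wp_def
  by (cases s; auto elim!: exec_elims(1-6)
      intro: exec.Skip[simplified] exec.Const[simplified] exec.Add[simplified]
        exec.Sub[simplified] exec.Load[simplified] exec.Store[simplified])+

lemma wp_Seq: "wp (Seq c1 c2) Q s \<longleftrightarrow> wp c1 (\<lambda>t. wp c2 (\<lambda>u. Q (t + u))) s"
  unfolding wp_def by (blast elim: exec_elims(7) intro: exec.Seq)

lemma wp_IfPos:
  "wp (IfPos r c1 c2) Q s \<longleftrightarrow>
    (if fst s r > 0 then wp c1 (\<lambda>t. Q (1 + t)) s else wp c2 (\<lambda>t. Q (1 + t)) s)"
proof -
  have "exec (IfPos r c1 c2) s t s' \<longleftrightarrow>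
      (\<exists>u. t = 1 + u \<and> exec (if fst s r > 0 then c1 else c2) s u s')" for t s'
    by (auto elim: exec_elims(8) intro: exec.IfTrue[simplified] exec.IfFalse[simplified])
  then show ?thesis unfolding wp_def by auto
qed

lemmas wp_simps = wp_atomic wp_Seq wp_IfPos

text \<open>Indexing \<open>I\<close> by the rounds still to come gives termination and the time
  bound at once: each of the \<open>m\<close> rounds costs one test and at most \<open>T\<close>
  steps, and the final test is the \<open>+ 1\<close>.\<close>

lemma wp_WhilePos:
  assumes "I m s"
    and step: "\<And>i s. i < m \<Longrightarrow> I (Suc i) s \<Longrightarrow> fst s r > 0 \<and> wp c (\<lambda>t s'. t \<le> T \<and> I i s') s"
    and exit: "\<And>s. I 0 s \<Longrightarrow> fst s r = 0"
    and post: "\<And>t s'. t \<le> m * Suc T + 1 \<Longrightarrow> I 0 s' \<Longrightarrow> Q t s'"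
  shows "wp (WhilePos r c) Q s"
proof -
  have "\<exists>t s'. exec (WhilePos r c) s t s' \<and> t \<le> i * Suc T + 1 \<and> I 0 s'" if "I i s" "i \<le> m" for i s
    using that
  proof (induction i arbitrary: s)
    case 0
    have "exec (WhilePos r c) s 1 s" by (rule exec.WhileFalse) (rule exit, fact)
    then show ?case using \<open>I 0 s\<close> by (intro exI[of _ 1] exI[of _ s]) simp
  next
    case (Suc i)
    then obtain t s' where t: "fst s r > 0" "exec c s t s'" "t \<le> T" "I i s'"
      using step[of i s] unfolding wp_def by auto
    then obtain u s'' where u: "exec (WhilePos r c) s' u s''" "u \<le> i * Suc T + 1" "I 0 s''"
      using Suc.IH[OF t(4)] Suc.prems by auto
    have "exec (WhilePos r c) s (1 + t + u) s''" by (rule exec.WhileTrue) fact+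
    moreover have "1 + t + u \<le> Suc i * Suc T + 1" using t(3) u(2) by simp
    ultimately show ?case using u(3) by blast
  qed
  then show ?thesis using assms(1) post unfolding wp_def by blast
qed

text \<open>The frame condition fixes the whole memory because every phase before the output only
  reads it.\<close>

definition same_except :: "nat set \<Rightarrow> ram_state \<Rightarrow> ram_state \<Rightarrow> bool" where
  "same_except X s s' \<longleftrightarrow> snd s' = snd s \<and> (\<forall>k. k \<notin> X \<longrightarrow> fst s' k = fst s k)"

section \<open>The algorithm\<close>

text \<open>
  The registers \<open>r_an\<close>, \<open>r_bn\<close> and \<open>r_un\<close> hold \<open>a * n\<close>, \<open>b * n\<close> and \<open>u * n\<close>, the addresses of the rows
  of the adjacency matrix. The ``no vertex'' row \<open>n\<close> starts just behind the input, where the memory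
  is zero, so that it needs no special treatment.
\<close>

abbreviation (input) "r_n \<equiv> 18 :: nat"
abbreviation (input) "r_odd \<equiv> 2 :: nat"
abbreviation (input) "r_one \<equiv> 3 :: nat"
abbreviation (input) "r_len \<equiv> 4 :: nat"
abbreviation (input) "r_a \<equiv> 5 :: nat"
abbreviation (input) "r_an \<equiv> 6 :: nat"
abbreviation (input) "r_b \<equiv> 7 :: nat"
abbreviation (input) "r_bn \<equiv> 8 :: nat"
abbreviation (input) "r_u \<equiv> 9 :: nat"
abbreviation (input) "r_un \<equiv> 10 :: nat"
abbreviation (input) "r_v \<equiv> 11 :: nat"
abbreviation (input) "r_bad \<equiv> 12 :: nat"
abbreviation (input) "r_found \<equiv> 13 :: nat"
abbreviation (input) "r_A \<equiv> 14 :: nat"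
abbreviation (input) "r_B \<equiv> 15 :: nat"
abbreviation (input) "r_x \<equiv> 16 :: nat"
abbreviation (input) "r_y \<equiv> 17 :: nat"

section \<open>Checking one candidate pair\<close>

definition Copy :: "nat \<Rightarrow> nat \<Rightarrow> ram_prog" where
  "Copy r q = Seq (Const r 0) (Add r r q)"

lemma wp_Copy: "r \<noteq> q \<Longrightarrow> wp (Copy r q) Q s \<longleftrightarrow> Q 2 ((fst s)(r := fst s q), snd s)"
  unfolding Copy_def by (simp add: wp_simps numeral_2_eq_2)

text \<open>The machine tests only for positivity; the sum of the two opposite truncated differences
  is positive exactly when the values differ.\<close>

definition if_differ :: "nat \<Rightarrow> nat \<Rightarrow> ram_prog \<Rightarrow> ram_prog" where
  "if_differ p q c = Seq (Sub r_x p q) (Seq (Sub r_y q p) (Seq (Add r_x r_x r_y) (IfPos r_x c Skip)))"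

definition unless_both :: "nat \<Rightarrow> ram_prog \<Rightarrow> ram_prog" where
  "unless_both row c = Seq (Add r_x row r_u) (Seq (Load r_x r_x) (Seq (Add r_y row r_v)
     (Seq (Load r_y r_y) (IfPos r_x (IfPos r_y Skip c) c))))"

definition check_pair :: ram_prog where
  "check_pair = if_differ r_u r_v (if_differ r_u r_a (if_differ r_v r_a (if_differ r_u r_b
     (if_differ r_v r_b (Seq (Add r_x r_un r_v) (Seq (Load r_x r_x) (IfPos r_x Skip
       (unless_both r_an (unless_both r_bn (Const r_bad 1))))))))))"

text \<open>The condition of \<open>mutual_visibility_set_Diff_iff\<close> read off the memory.
  Excluding \<open>a\<close> and \<open>b\<close> is turned into disjuncts, so that \<open>u\<close>
  and \<open>v\<close> can run through all indices.\<close>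

definition compatible :: "(nat \<Rightarrow> nat) \<Rightarrow> nat \<Rightarrow> nat \<Rightarrow> nat \<Rightarrow> nat \<Rightarrow> nat \<Rightarrow> bool" where
  "compatible M n a b u v \<longleftrightarrow> u = v \<or> u = a \<or> v = a \<or> u = b \<or> v = b \<or> M (u * n + v) > 0 \<or>
     M (a * n + u) > 0 \<and> M (a * n + v) > 0 \<or> M (b * n + u) > 0 \<and> M (b * n + v) > 0"

lemma wp_if_differ:
  assumes "p \<notin> {r_x, r_y}" "q \<notin> {r_x, r_y}"
  shows "wp (if_differ p q c) Q s \<longleftrightarrow>
    (let s' = ((fst s)(r_y := fst s q - fst s p, r_x := fst s p - fst s q + (fst s q - fst s p)), snd s)
     in if fst s p = fst s q then Q 5 s' else wp c (\<lambda>t. Q (4 + t)) s')"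
  using assms unfolding if_differ_def
  by (auto simp: wp_simps Let_def eval_nat_numeral)

lemma wp_unless_both:
  assumes "row \<notin> {r_x, r_y}"
  shows "wp (unless_both row c) Q s \<longleftrightarrow>
    (let x = snd s (fst s row + fst s r_u); y = snd s (fst s row + fst s r_v);
         s' = ((fst s)(r_x := x, r_y := y), snd s)
     in if x > 0 then if y > 0 then Q 7 s' else wp c (\<lambda>t. Q (6 + t)) s'
        else wp c (\<lambda>t. Q (5 + t)) s')"
  using assms unfolding unless_both_def
  by (simp add: wp_simps Let_def eval_nat_numeral)

text \<open>The nested tests follow the disjuncts of \<open>compatible\<close> in order, and
  \<open>r_bad\<close> is set only if all of them fail. The bound \<open>50\<close> has slack, as
  have the constants of the later bounds.\<close>

lemma wp_check_pair:
  assumes "fst s r_an = fst s r_a * fst s r_n" "fst s r_bn = fst s r_b * fst s r_n"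
    and "fst s r_un = fst s r_u * fst s r_n"
  shows "wp check_pair (\<lambda>t s'. t \<le> 50 \<and> same_except {r_bad, r_x, r_y} s s' \<and>
      fst s' r_bad = (if compatible (snd s) (fst s r_n) (fst s r_a) (fst s r_b) (fst s r_u) (fst s r_v)
        then fst s r_bad else 1)) s"
  using assms unfolding check_pair_def
  by (simp add: wp_if_differ wp_unless_both wp_simps Let_def same_except_def compatible_def)

definition check_row :: ram_prog where
  "check_row = Seq (Copy r_v r_n) (WhilePos r_v (Seq (Sub r_v r_v r_one) check_pair))"

lemma wp_check_row:
  assumes "fst s r_one = 1" "fst s r_an = fst s r_a * fst s r_n"
    and "fst s r_bn = fst s r_b * fst s r_n" "fst s r_un = fst s r_u * fst s r_n"
  shows "wp check_row (\<lambda>t s'. t \<le> 60 * Suc (fst s r_n) \<and> same_except {r_v, r_bad, r_x, r_y} s s' \<and>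
      (fst s' r_bad = 0 \<longleftrightarrow> fst s r_bad = 0 \<and> (\<forall>v < fst s r_n.
        compatible (snd s) (fst s r_n) (fst s r_a) (fst s r_b) (fst s r_u) v))) s"
    (is "wp _ ?Q s")
proof -
  let ?I = "\<lambda>i s'. same_except {r_v, r_bad, r_x, r_y} s s' \<and> fst s' r_v = i \<and> i \<le> fst s r_n \<and>
      (fst s' r_bad = 0 \<longleftrightarrow> fst s r_bad = 0 \<and> (\<forall>v. i \<le> v \<and> v < fst s r_n \<longrightarrow>
        compatible (snd s) (fst s r_n) (fst s r_a) (fst s r_b) (fst s r_u) v))"
  have "wp (WhilePos r_v (Seq (Sub r_v r_v r_one) check_pair)) (\<lambda>t. ?Q (2 + t))
      ((fst s)(r_v := fst s r_n), snd s)"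
  proof (rule wp_WhilePos[where I = ?I and m = "fst s r_n" and T = 51])
    fix i s' assume "i < fst s r_n" and I: "?I (Suc i) s'"
    \<comment> \<open>Going from \<open>Suc i\<close> to \<open>i\<close> adds just column
      \<open>i\<close> to the columns already checked.\<close>
    have le_iff: "i \<le> v \<longleftrightarrow> v = i \<or> Suc i \<le> v" for v by auto
    show "fst s' r_v > 0 \<and> wp (Seq (Sub r_v r_v r_one) check_pair) (\<lambda>t s'. t \<le> 51 \<and> ?I i s') s'"
      using I assms \<open>i < fst s r_n\<close>
      by (auto simp: wp_simps same_except_def le_iff intro!: wp_mono[OF wp_check_pair] split: if_splits)
  qed (auto simp: same_except_def)
  then show ?thesis unfolding check_row_def by (simp add: wp_Seq wp_Copy)
qed

text \<open>Row addresses are kept without multiplication: \<open>r_un\<close> starts at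
  \<open>n * n\<close> and drops by \<open>n\<close> whenever \<open>u\<close> drops by one.\<close>

definition check_all :: ram_prog where
  "check_all = Seq (Copy r_u r_n) (Seq (Copy r_un r_len)
     (WhilePos r_u (Seq (Sub r_u r_u r_one) (Seq (Sub r_un r_un r_n) check_row))))"

lemma wp_check_all:
  assumes "fst s r_one = 1" "fst s r_len = fst s r_n * fst s r_n"
    and "fst s r_an = fst s r_a * fst s r_n" "fst s r_bn = fst s r_b * fst s r_n"
  shows "wp check_all (\<lambda>t s'. t \<le> 70 * (Suc (fst s r_n))^2 \<and>
      same_except {r_u, r_un, r_v, r_bad, r_x, r_y} s s' \<and>
      (fst s' r_bad = 0 \<longleftrightarrow> fst s r_bad = 0 \<and> (\<forall>u < fst s r_n. \<forall>v < fst s r_n.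
        compatible (snd s) (fst s r_n) (fst s r_a) (fst s r_b) u v))) s"
    (is "wp _ ?Q s")
proof -
  let ?c = "Seq (Sub r_u r_u r_one) (Seq (Sub r_un r_un r_n) check_row)"
  let ?I = "\<lambda>i s'. same_except {r_u, r_un, r_v, r_bad, r_x, r_y} s s' \<and> fst s' r_u = i \<and>
      fst s' r_un = i * fst s r_n \<and> i \<le> fst s r_n \<and>
      (fst s' r_bad = 0 \<longleftrightarrow> fst s r_bad = 0 \<and> (\<forall>u. i \<le> u \<and> u < fst s r_n \<longrightarrow>
        (\<forall>v < fst s r_n. compatible (snd s) (fst s r_n) (fst s r_a) (fst s r_b) u v)))"
  have "wp (WhilePos r_u ?c) (\<lambda>t. ?Q (2 + (2 + t)))
      ((fst s)(r_u := fst s r_n, r_un := fst s r_len), snd s)"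
  proof (rule wp_WhilePos[where I = ?I and m = "fst s r_n" and T = "60 * Suc (fst s r_n) + 2"])
    fix i s' assume "i < fst s r_n" and I: "?I (Suc i) s'"
    have le_iff: "i \<le> v \<longleftrightarrow> v = i \<or> Suc i \<le> v" for v by auto
    show "fst s' r_u > 0 \<and> wp ?c (\<lambda>t s'. t \<le> 60 * Suc (fst s r_n) + 2 \<and> ?I i s') s'"
      using I assms \<open>i < fst s r_n\<close>
      by (auto simp: wp_simps same_except_def le_iff intro!: wp_mono[OF wp_check_row])
  next
    fix t s' assume "t \<le> fst s r_n * Suc (60 * Suc (fst s r_n) + 2) + 1" "?I 0 s'"
    then show "?Q (2 + (2 + t)) s'"
      by (auto simp: same_except_def power2_eq_square algebra_simps)
  qed (use assms in \<open>auto simp: same_except_def\<close>)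
  then show ?thesis unfolding check_all_def by (simp add: wp_Seq wp_Copy)
qed

section \<open>Lexicographic search over pairs\<close>

definition good :: "(nat \<Rightarrow> nat) \<Rightarrow> nat \<Rightarrow> nat \<Rightarrow> nat \<Rightarrow> bool" where
  "good M n a b \<longleftrightarrow> (\<forall>u < n. \<forall>v < n. compatible M n a b u v)"

text \<open>After a success the remaining pairs are still checked but no longer recorded. This fixes
  the number of rounds, as \<open>wp_WhilePos\<close> requires, and keeps the first good
  pair.\<close>

definition try_pair :: ram_prog where
  "try_pair = Seq (Const r_bad 0) (Seq check_all (IfPos r_bad Skip (IfPos r_found Skip
     (Seq (Const r_found 1) (Seq (Copy r_A r_a) (Copy r_B r_b))))))"

lemma wp_try_pair:
  assumes "fst s r_one = 1" "fst s r_len = fst s r_n * fst s r_n"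
    and "fst s r_an = fst s r_a * fst s r_n" "fst s r_bn = fst s r_b * fst s r_n"
  shows "wp try_pair (\<lambda>t s'. t \<le> 80 * (Suc (fst s r_n))^2 \<and>
      same_except {r_found, r_A, r_B, r_u, r_un, r_v, r_bad, r_x, r_y} s s' \<and>
      (if good (snd s) (fst s r_n) (fst s r_a) (fst s r_b) \<and> fst s r_found = 0
       then fst s' r_found = 1 \<and> fst s' r_A = fst s r_a \<and> fst s' r_B = fst s r_b
       else fst s' r_found = fst s r_found \<and> fst s' r_A = fst s r_A \<and> fst s' r_B = fst s r_B)) s"
proof -
  \<comment> \<open>The summand \<open>10\<close> covers the instructions of \<open>try_pair\<close>
    outside \<open>check_all\<close>.\<close>
  have bound: "t + 10 \<le> 80 * (Suc (fst s r_n))^2" if "t \<le> 70 * (Suc (fst s r_n))^2" for t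
  proof -
    have "1 \<le> (Suc (fst s r_n))^2" by simp
    then show ?thesis using that by linarith
  qed
  show ?thesis
    using assms unfolding try_pair_def
    by (auto simp: wp_simps wp_Copy same_except_def good_def dest!: bound intro!: wp_mono[OF wp_check_all])
qed

text \<open>
  The state of the search after all pairs from \<open>(N, N)\<close> down to \<open>(a, b)\<close> have been tried: \<open>f\<close> tells
  whether a good pair has been found, and \<open>(A, B)\<close> is the first one.
\<close>

definition searched :: "nat \<Rightarrow> (nat \<Rightarrow> nat \<Rightarrow> bool) \<Rightarrow> nat \<Rightarrow> nat \<Rightarrow> nat \<Rightarrow> nat \<Rightarrow> nat \<Rightarrow> bool" where
  "searched N g f A B a b \<longleftrightarrow>
    (if f = 0 then \<forall>a' \<le> N. \<forall>b' \<le> N. a < a' \<or> a = a' \<and> b \<le> b' \<longrightarrow> \<not> g a' b'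
     else A \<le> N \<and> B \<le> N \<and> g A B \<and>
       (\<forall>a' \<le> N. \<forall>b' \<le> N. g a' b' \<longrightarrow> a' < A \<or> a' = A \<and> b' \<le> B))"

lemma searched_start: "searched N g 0 A B (Suc N) 0"
  by (simp add: searched_def)

text \<open>The positions \<open>(Suc a, 0)\<close> and \<open>(a, Suc N)\<close> mark the same
  moment: one row is finished and the next not yet begun.\<close>

lemma searched_next_row: "searched N g f A B (Suc a) 0 \<Longrightarrow> searched N g f A B a (Suc N)"
proof (cases "f = 0")
  case True
  assume "searched N g f A B (Suc a) 0"
  then have not_g: "\<not> g a' b'" if "a' \<le> N" "b' \<le> N" "Suc a \<le> a'" for a' b'
    using True that unfolding searched_def by (auto simp: le_less)
  then show ?thesis using True unfolding searched_def by auto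
qed (simp add: searched_def)

text \<open>Only \<open>(a, b)\<close> is new among the tried pairs. If it is the first good one,
  all lexicographically larger pairs are bad, so it is the maximum; a pair found earlier is
  kept.\<close>

lemma searched_step:
  assumes "searched N g f A B a (Suc b)" "a \<le> N" "b \<le> N"
    and "if g a b \<and> f = 0 then f' = 1 \<and> A' = a \<and> B' = b else f' = f \<and> A' = A \<and> B' = B"
  shows "searched N g f' A' B' a b"
proof (cases "f = 0")
  case True
  have not_g: "\<not> g a' b'" if "a' \<le> N" "b' \<le> N" "a < a' \<or> a = a' \<and> Suc b \<le> b'" for a' b'
    using assms(1) True that unfolding searched_def by auto
  show ?thesis
  proof (cases "g a b")
    case g: True
    have "a' < a \<or> a' = a \<and> b' \<le> b" if "a' \<le> N" "b' \<le> N" "g a' b'" for a' b'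
      using not_g[OF that(1,2)] that(3) by force
    then show ?thesis using assms(2-4) True g unfolding searched_def by auto
  next
    case False
    have "\<not> g a' b'" if "a' \<le> N" "b' \<le> N" "a < a' \<or> a = a' \<and> b \<le> b'" for a' b'
      using not_g[OF that(1,2)] that(3) False by (cases "a = a' \<and> b = b'") auto
    then show ?thesis using assms(4) True False unfolding searched_def by auto
  qed
next
  case False
  then show ?thesis using assms unfolding searched_def by auto
qed

abbreviation state_searched :: "ram_state \<Rightarrow> nat \<Rightarrow> nat \<Rightarrow> bool" where
  "state_searched s \<equiv> searched (fst s r_n) (good (snd s) (fst s r_n)) (fst s r_found) (fst s r_A) (fst s r_B)"

abbreviation (input) "work_regs \<equiv> {r_b, r_bn, r_found, r_A, r_B, r_u, r_un, r_v, r_bad, r_x, r_y}"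

text \<open>Starting at \<open>Suc n\<close> and decrementing first makes \<open>b\<close> run from
  \<open>n\<close>, the missing vertex, down to \<open>0\<close>; accordingly \<open>r_bn\<close>
  starts at \<open>n * n + n\<close>.\<close>

definition search_row :: ram_prog where
  "search_row = Seq (Add r_b r_n r_one) (Seq (Add r_bn r_len r_n)
     (WhilePos r_b (Seq (Sub r_b r_b r_one) (Seq (Sub r_bn r_bn r_n) try_pair))))"

lemma wp_search_row:
  assumes "fst s r_one = 1" "fst s r_len = fst s r_n * fst s r_n"
    and "fst s r_an = fst s r_a * fst s r_n" "fst s r_a \<le> fst s r_n" "state_searched s (Suc (fst s r_a)) 0"
  shows "wp search_row (\<lambda>t s'. t \<le> 90 * (Suc (fst s r_n))^3 \<and>
      same_except work_regs s s' \<and> state_searched s' (fst s r_a) 0) s"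
    (is "wp _ ?Q s")
proof -
  let ?c = "Seq (Sub r_b r_b r_one) (Seq (Sub r_bn r_bn r_n) try_pair)"
  let ?I = "\<lambda>i s'. same_except work_regs s s' \<and> fst s' r_b = i \<and>
      fst s' r_bn = i * fst s r_n \<and> i \<le> Suc (fst s r_n) \<and> state_searched s' (fst s r_a) i"
  have "wp (WhilePos r_b ?c) (\<lambda>t. ?Q (2 + t))
      ((fst s)(r_b := fst s r_n + fst s r_one, r_bn := fst s r_len + fst s r_n), snd s)"
  proof (rule wp_WhilePos[where I = ?I and m = "Suc (fst s r_n)" and T = "80 * (Suc (fst s r_n))^2 + 2"])
    show "?I (Suc (fst s r_n))
        ((fst s)(r_b := fst s r_n + fst s r_one, r_bn := fst s r_len + fst s r_n), snd s)"
      using assms searched_next_row by (auto simp: same_except_def)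
  next
    fix i s' assume "i < Suc (fst s r_n)" and I: "?I (Suc i) s'"
    show "fst s' r_b > 0 \<and> wp ?c (\<lambda>t s'. t \<le> 80 * (Suc (fst s r_n))^2 + 2 \<and> ?I i s') s'"
      using I assms \<open>i < Suc (fst s r_n)\<close>
      by (auto simp: wp_simps same_except_def simp del: One_nat_def
          intro!: wp_mono[OF wp_try_pair] elim!: searched_step)
  next
    fix t s' assume t: "t \<le> Suc (fst s r_n) * Suc (80 * (Suc (fst s r_n))^2 + 2) + 1" "?I 0 s'"
    \<comment> \<open>The cubic term absorbs the linear and constant overhead of the loop.\<close>
    have "1 \<le> (Suc (fst s r_n))^3" "Suc (fst s r_n) \<le> (Suc (fst s r_n))^3" 
      by (simp_all add: self_le_power)
    then show "?Q (2 + t) s'"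
      using t by (auto simp: same_except_def power2_eq_square power3_eq_cube algebra_simps)
  qed (auto simp: same_except_def)
  then show ?thesis unfolding search_row_def by (simp add: wp_simps numeral_2_eq_2)
qed

definition search :: ram_prog where
  "search = Seq (Add r_a r_n r_one) (Seq (Add r_an r_len r_n)
     (WhilePos r_a (Seq (Sub r_a r_a r_one) (Seq (Sub r_an r_an r_n) search_row))))"

lemma wp_search:
  assumes "fst s r_one = 1" "fst s r_len = fst s r_n * fst s r_n" "fst s r_found = 0"
  shows "wp search (\<lambda>t s'. t \<le> 100 * (Suc (fst s r_n))^4 \<and>
      same_except (insert r_a (insert r_an work_regs)) s s' \<and> state_searched s' 0 0) s"
    (is "wp _ ?Q s")
proof -
  let ?c = "Seq (Sub r_a r_a r_one) (Seq (Sub r_an r_an r_n) search_row)"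
  let ?I = "\<lambda>i s'. same_except (insert r_a (insert r_an work_regs)) s s' \<and> fst s' r_a = i \<and>
      fst s' r_an = i * fst s r_n \<and> i \<le> Suc (fst s r_n) \<and> state_searched s' i 0"
  have "wp (WhilePos r_a ?c) (\<lambda>t. ?Q (2 + t))
      ((fst s)(r_a := fst s r_n + fst s r_one, r_an := fst s r_len + fst s r_n), snd s)"
  proof (rule wp_WhilePos[where I = ?I and m = "Suc (fst s r_n)" and T = "90 * (Suc (fst s r_n))^3 + 2"])
    show "?I (Suc (fst s r_n))
        ((fst s)(r_a := fst s r_n + fst s r_one, r_an := fst s r_len + fst s r_n), snd s)"
      using assms searched_start by (auto simp: same_except_def)
  next
    fix i s' assume "i < Suc (fst s r_n)" and I: "?I (Suc i) s'"
    then show "fst s' r_a > 0 \<and> wp ?c (\<lambda>t s'. t \<le> 90 * (Suc (fst s r_n))^3 + 2 \<and> ?I i s') s'"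
      using assms
      by (auto simp: wp_simps same_except_def intro!: wp_mono[OF wp_search_row])
  next
    fix t s' assume t: "t \<le> Suc (fst s r_n) * Suc (90 * (Suc (fst s r_n))^3 + 2) + 1" "?I 0 s'"
    have "1 \<le> (Suc (fst s r_n))^4" "Suc (fst s r_n) \<le> (Suc (fst s r_n))^4" 
      by (simp_all add: self_le_power)
    moreover have "(Suc (fst s r_n))^4 = Suc (fst s r_n) * (Suc (fst s r_n))^3"
      by (simp add: eval_nat_numeral)
    ultimately have "2 + t \<le> 100 * (Suc (fst s r_n))^4" using t(1) by (simp add: distrib_left)
    then show "?Q (2 + t) s'" using t(2) by simp
  qed (auto simp: same_except_def)
  then show ?thesis unfolding search_def by (simp add: wp_simps numeral_2_eq_2)
qed

section \<open>Setup, output and the whole program\<close>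

text \<open>Only the input length \<open>n * n\<close> is given. Its square root is the number of
  consecutive odd numbers 1, 3, 5, ... that can be subtracted until zero is reached.\<close>

definition setup_regs :: ram_prog where
  "setup_regs = Seq (Const r_one 1) (Seq (Const r_odd 1) (Seq (Copy r_len 0)
     (WhilePos 0 (Seq (Sub 0 0 r_odd) (Seq (Add r_n r_n r_one)
       (Seq (Add r_odd r_odd r_one) (Add r_odd r_odd r_one)))))))"

lemma wp_setup_regs:
  assumes "fst s 0 = n * n" "fst s r_n = 0"
  shows "wp setup_regs (\<lambda>t s'. t \<le> 10 * Suc n \<and> same_except {0, r_n, r_odd, r_one, r_len} s s' \<and>
      fst s' r_n = n \<and> fst s' r_len = n * n \<and> fst s' r_one = 1) s"
    (is "wp _ ?Q s")
proof -
  let ?c = "Seq (Sub 0 0 r_odd) (Seq (Add r_n r_n r_one)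
       (Seq (Add r_odd r_odd r_one) (Add r_odd r_odd r_one)))"
  \<comment> \<open>With \<open>k\<close> in \<open>r_n\<close>, the first \<open>k\<close> odd
    numbers, of sum \<open>k * k\<close>, have been subtracted, and the next one is
    \<open>2 * k + 1\<close>.\<close>
  let ?I = "\<lambda>i s'. same_except {0, r_n, r_odd, r_one, r_len} s s' \<and> i + fst s' r_n = n \<and>
      fst s' 0 + fst s' r_n * fst s' r_n = n * n \<and> fst s' r_odd = 2 * fst s' r_n + 1 \<and>
      fst s' r_len = n * n \<and> fst s' r_one = 1"
  have "wp (WhilePos 0 ?c) (\<lambda>t. ?Q (1 + (1 + (2 + t))))
      ((fst s)(r_one := 1, r_odd := 1, r_len := fst s 0), snd s)"
  proof (rule wp_WhilePos[where I = ?I and m = n and T = 4])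
    fix i s' assume I: "?I (Suc i) s'"
    let ?k = "fst s' r_n"
    \<comment> \<open>As \<open>k < n\<close>, at least \<open>2 * k + 1\<close> remains in register
      \<open>0\<close>: the test succeeds and the truncated subtraction is exact.\<close>
    have "n * n = (?k + 1 + i) * (?k + 1 + i)" using I by (simp add: add.commute)
    also have "\<dots> \<ge> (?k + 1) * (?k + 1)" by (intro mult_le_mono) auto
    finally have "2 * ?k + 1 \<le> fst s' 0" using I by simp
    then show "fst s' 0 > 0 \<and> wp ?c (\<lambda>t s'. t \<le> 4 \<and> ?I i s') s'"
      using I by (auto simp: wp_simps same_except_def)
  qed (use assms in \<open>auto simp: same_except_def\<close>)
  then show ?thesis unfolding setup_regs_def by (simp add: wp_simps wp_Copy)
qed

text \<open>All output cells are set to 1 before the cells \<open>A\<close> and \<open>B\<close> are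
  cleared. If one of these is \<open>n\<close>, the cleared cell lies just behind the
  output.\<close>

definition write_output :: ram_prog where
  "write_output = Seq (Copy r_v r_n) (Seq (WhilePos r_v (Seq (Sub r_v r_v r_one) (Store r_v r_one)))
     (Seq (Const r_x 0) (Seq (Store r_A r_x) (Seq (Store r_B r_x) (Copy 0 r_n)))))"

lemma wp_write_output:
  assumes "fst s r_one = 1"
  shows "wp write_output (\<lambda>t s'. t \<le> 10 * Suc (fst s r_n) \<and> fst s' 0 = fst s r_n \<and>
      (\<forall>i < fst s r_n. snd s' i = of_bool (i \<notin> {fst s r_A, fst s r_B}))) s"
    (is "wp _ ?Q s")
proof -
  let ?I = "\<lambda>i s'. (\<forall>k. k \<noteq> r_v \<longrightarrow> fst s' k = fst s k) \<and> fst s' r_v = i \<and>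
      (\<forall>j. i \<le> j \<and> j < fst s r_n \<longrightarrow> snd s' j = 1)"
  let ?rest = "Seq (Const r_x 0) (Seq (Store r_A r_x) (Seq (Store r_B r_x) (Copy 0 r_n)))"
  have "wp (WhilePos r_v (Seq (Sub r_v r_v r_one) (Store r_v r_one)))
      (\<lambda>t. wp ?rest (\<lambda>u. ?Q (2 + (t + u)))) ((fst s)(r_v := fst s r_n), snd s)"
  proof (rule wp_WhilePos[where I = ?I and m = "fst s r_n" and T = 2])
    fix i and s' :: ram_state assume "?I (Suc i) s'"
    then show "fst s' r_v > 0 \<and>
        wp (Seq (Sub r_v r_v r_one) (Store r_v r_one)) (\<lambda>t s'. t \<le> 2 \<and> ?I i s') s'"
      using assms by (auto simp: wp_simps)
  next
    fix t and s' :: ram_state assume "t \<le> fst s r_n * Suc 2 + 1" "?I 0 s'"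
    then show "wp ?rest (\<lambda>u. ?Q (2 + (t + u))) s'"
      by (auto simp: wp_simps wp_Copy)
  qed auto
  then show ?thesis unfolding write_output_def by (simp add: wp_Seq wp_Copy)
qed

definition max_visibility_prog :: ram_prog where
  "max_visibility_prog = Seq setup_regs (Seq search write_output)"

text \<open>Setup and search leave the memory untouched, so \<open>good\<close> refers to its
  initial content \<open>snd s\<close>.\<close>

lemma wp_max_visibility_prog:
  assumes "fst s 0 = n * n" "fst s r_n = 0" "fst s r_found = 0"
  shows "wp max_visibility_prog (\<lambda>t s'. t \<le> 120 * (Suc n)^4 \<and> fst s' 0 = n \<and>
      (\<exists>f A B. searched n (good (snd s) n) f A B 0 0 \<and>
        (\<forall>i < n. snd s' i = of_bool (i \<notin> {A, B})))) s"
proof -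
  have pow: "Suc n \<le> (Suc n)^4" by (rule self_le_power) auto
  have "wp search (\<lambda>u. wp write_output (\<lambda>v s'. t + (u + v) \<le> 120 * (Suc n)^4 \<and> fst s' 0 = n \<and>
      (\<exists>f A B. searched n (good (snd s) n) f A B 0 0 \<and>
        (\<forall>i < n. snd s' i = of_bool (i \<notin> {A, B}))))) s1"
    if s1: "t \<le> 10 * Suc n" "same_except {0, r_n, r_odd, r_one, r_len} s s1"
      "fst s1 r_n = n" "fst s1 r_len = n * n" "fst s1 r_one = 1" for t s1
  proof (rule wp_mono[OF wp_search])
    fix u s2
    assume s2: "u \<le> 100 * (Suc (fst s1 r_n))^4 \<and>
      same_except (insert r_a (insert r_an work_regs)) s1 s2 \<and> state_searched s2 0 0"
    then have srch: "searched n (good (snd s) n) (fst s2 r_found) (fst s2 r_A) (fst s2 r_B) 0 0"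
      and regs: "fst s2 r_n = n" "fst s2 r_one = 1"
      using s1 by (auto simp: same_except_def)
    show "wp write_output (\<lambda>v s'. t + (u + v) \<le> 120 * (Suc n)^4 \<and> fst s' 0 = n \<and>
      (\<exists>f A B. searched n (good (snd s) n) f A B 0 0 \<and>
        (\<forall>i < n. snd s' i = of_bool (i \<notin> {A, B})))) s2"
    proof (rule wp_mono[OF wp_write_output[OF regs(2)]], intro conjI)
      fix v s'
      assume s': "v \<le> 10 * Suc (fst s2 r_n) \<and> fst s' 0 = fst s2 r_n \<and>
        (\<forall>i < fst s2 r_n. snd s' i = of_bool (i \<notin> {fst s2 r_A, fst s2 r_B}))"
      then have "v \<le> 10 * Suc n" "u \<le> 100 * (Suc n)^4" using regs s1(3) s2 by auto
      then have "t + (u + v) \<le> 10 * Suc n + (100 * (Suc n)^4 + 10 * Suc n)"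
        using s1(1) by (intro add_mono)
      also have "\<dots> \<le> 10 * (Suc n)^4 + (100 * (Suc n)^4 + 10 * (Suc n)^4)"
        using pow by (intro add_mono mult_le_mono) simp_all
      finally show "t + (u + v) \<le> 120 * (Suc n)^4" by simp
      show "fst s' 0 = n" using s' regs by simp
      show "\<exists>f A B. searched n (good (snd s) n) f A B 0 0 \<and>
          (\<forall>i < n. snd s' i = of_bool (i \<notin> {A, B}))"
        using srch s' regs(1) by metis
    qed
  qed (use s1 assms in \<open>auto simp: same_except_def\<close>)
  then show ?thesis
    unfolding max_visibility_prog_def wp_Seq
    by (intro wp_mono[OF wp_setup_regs[OF assms(1,2)]]) blast
qed

section \<open>The adjacency matrix in memory\<close>

text \<open>The number \<open>m\<close> of rows is kept apart from the row width \<open>n\<close>,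
  so that the induction can append one row at a time.\<close>

lemma concat_rows:
  "length (concat (map (\<lambda>i. map (f i) [0..<n]) [0..<m])) = m * n"
  "i < m \<Longrightarrow> j < n \<Longrightarrow> concat (map (\<lambda>i. map (f i) [0..<n]) [0..<m]) ! (i * n + j) = f i j"
proof (induction m)
  case (Suc m)
  {
    case 1
    show ?case using Suc(1) by simp
  next
    case 2
    show ?case
    proof (cases "i < m")
      case True
      then have "i * n + j < m * n"
        using 2(2) mult_le_mono1[of "Suc i" m n] by simp
      then show ?thesis using Suc(2) Suc(1) True 2 by (simp add: nth_append)
    next
      case False
      then have "i = m" using 2 by simp
      then show ?thesis using Suc(1) 2 by (simp add: nth_append)
    qed
  }
qed auto

text \<open>Row \<open>a = n\<close> is included: its cells lie behind the input and hold zero, in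
  accordance with \<open>n\<close> having no arcs.\<close>

lemma adjacency_matrix_state:
  assumes G: "pair_wf_digraph G" "pverts G = {..<n}"
  shows "length (adjacency_matrix G) = n * n"
    and "a \<le> n \<Longrightarrow> u < n \<Longrightarrow>
      snd (input_state (adjacency_matrix G)) (a * n + u) > 0 \<longleftrightarrow> (a, u) \<in> parcs G"
proof -
  have eq: "adjacency_matrix G = concat (map (\<lambda>i. map (\<lambda>j. (i, j) \<in> parcs G) [0..<n]) [0..<n])"
    unfolding adjacency_matrix_def using G(2) by simp
  show len: "length (adjacency_matrix G) = n * n"
    unfolding eq by (rule concat_rows)
  assume "a \<le> n" "u < n"
  show "snd (input_state (adjacency_matrix G)) (a * n + u) > 0 \<longleftrightarrow> (a, u) \<in> parcs G"
  proof (cases "a = n")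
    case True
    then have "(a, u) \<notin> parcs G" using pair_wf_digraph.in_arcsD1[OF G(1)] G(2) by auto
    then show ?thesis using True len by (simp add: input_state_def)
  next
    case False
    then have "a < n" using \<open>a \<le> n\<close> by simp
    then have "a * n + u < n * n" using \<open>u < n\<close> mult_le_mono1[of "Suc a" n n] by simp
    then show ?thesis
      using concat_rows(2)[of a n u n "\<lambda>i j. (i, j) \<in> parcs G"] \<open>a < n\<close> \<open>u < n\<close> len
      by (simp add: input_state_def eq)
  qed
qed

lemma good_iff_mutual_visibility_set:
  assumes G: "connected_cograph G" "pverts G = {..<n}" and ab: "a \<le> n" "b \<le> n"
  shows "good (snd (input_state (adjacency_matrix G))) n a b \<longleftrightarrow>
    mutual_visibility_set G ({..<n} - {a, b})"
proof -
  interpret cograph G by (rule connected_cograph_imp_cograph) (rule G)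
  have "good (snd (input_state (adjacency_matrix G))) n a b \<longleftrightarrow> (\<forall>u < n. \<forall>v < n.
      u = v \<or> u = a \<or> v = a \<or> u = b \<or> v = b \<or> (u, v) \<in> parcs G \<or>
      (a, u) \<in> parcs G \<and> (a, v) \<in> parcs G \<or> (b, u) \<in> parcs G \<and> (b, v) \<in> parcs G)"
    unfolding good_def compatible_def
    using ab by (simp add: adjacency_matrix_state[OF pair_wf_digraph G(2)] cong: conj_cong)
  also have "\<dots> \<longleftrightarrow> (\<forall>u \<in> {..<n} - {a, b}. \<forall>v \<in> {..<n} - {a, b}. u = v \<or> (u, v) \<in> parcs G \<or>
      (a, u) \<in> parcs G \<and> (a, v) \<in> parcs G \<or> (b, u) \<in> parcs G \<and> (b, v) \<in> parcs G)"
    (is "?L \<longleftrightarrow> ?R")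
  proof
    assume ?L
    then show ?R by blast
  next
    assume R: ?R
    show ?L
    proof (intro allI impI)
      fix u v assume "u < n" "v < n"
      then show "u = v \<or> u = a \<or> v = a \<or> u = b \<or> v = b \<or> (u, v) \<in> parcs G \<or>
          (a, u) \<in> parcs G \<and> (a, v) \<in> parcs G \<or> (b, u) \<in> parcs G \<and> (b, v) \<in> parcs G"
        using R[THEN bspec[of _ _ u], THEN bspec[of _ _ v]] by fastforce
    qed
  qed
  also have "\<dots> \<longleftrightarrow> mutual_visibility_set G ({..<n} - {a, b})"
    using mutual_visibility_set_Diff_iff[of a b] unfolding G(2) by (rule sym)
  finally show ?thesis .
qed

lemma max_visibility_prog_correct:
  assumes G: "connected_cograph G" "pverts G = {..<n}"
  shows "\<exists>t s P. exec max_visibility_prog (input_state (adjacency_matrix G)) t s \<and>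
    t \<le> 120 * (Suc n)^4 \<and> is_output s (characteristic_vector G P) \<and>
    mutual_visibility_set G P \<and> card P = mutual_visibility_number G"
proof -
  interpret cograph G by (rule connected_cograph_imp_cograph) (rule G)
  let ?s = "input_state (adjacency_matrix G)"
  have "fst ?s 0 = n * n" "fst ?s r_n = 0" "fst ?s r_found = 0"
    using adjacency_matrix_state(1)[OF pair_wf_digraph G(2)] by (simp_all add: input_state_def)
  from wp_max_visibility_prog[OF this] obtain t s f A B where
    run: "exec max_visibility_prog ?s t s" "t \<le> 120 * (Suc n)^4"
    and out: "fst s 0 = n" "\<forall>i < n. snd s i = of_bool (i \<notin> {A, B})"
    and srch: "searched n (good (snd ?s) n) f A B 0 0"
    unfolding wp_def by blast
  note good_iff = good_iff_mutual_visibility_set[OF G]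
  obtain a b where ab: "a < n" "b < n" "mutual_visibility_set G ({..<n} - {a, b})"
    using ex_mutual_visibility_set_Diff G(2) by auto
  then have "good (snd ?s) n a b" using good_iff by simp
  \<comment> \<open>A good pair of actual vertices lies in the search range, so the search cannot
    end without success.\<close>
  then have "f \<noteq> 0"
    using srch less_imp_le[OF ab(1)] less_imp_le[OF ab(2)] unfolding searched_def
    by (metis gr0I zero_le)
  then have AB: "A \<le> n" "B \<le> n" "good (snd ?s) n A B"
    and lex: "\<And>a' b'. a' \<le> n \<Longrightarrow> b' \<le> n \<Longrightarrow> good (snd ?s) n a' b' \<Longrightarrow> a' < A \<or> a' = A \<and> b' \<le> B"
    using srch unfolding searched_def by simp_all
  let ?P = "{..<n} - {A, B}"
  have P: "mutual_visibility_set G ?P" using AB good_iff by simp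
  have "card ?P = mutual_visibility_number G"
    using first_pair_is_maximum[OF G P AB(1,2)] lex good_iff by simp
  moreover have "is_output s (characteristic_vector G ?P)"
    using out G(2) by (auto simp: is_output_def characteristic_vector_def)
  ultimately show ?thesis using run P by blast
qed

section \<open>Polynomial bound in the input length\<close>

text \<open>For positive \<open>n\<close>, \<open>Suc n\<close> is at most \<open>2 * n\<close>,
  whence the factor \<open>16\<close>; the summand \<open>16\<close> covers \<open>n = 0\<close>.
  The right-hand side is quadratic in the input length \<open>n * n\<close>.\<close>

lemma Suc_power4_le: "(Suc n)^4 \<le> 16 * (n * n)^2 + 16"
proof (cases n)
  case (Suc m)
  have "(Suc n)^4 \<le> (2 * n)^4" using Suc by (intro power_mono) auto
  also have "\<dots> = 16 * (n * n)^2" by (simp add: power_mult_distrib power2_eq_square power4_eq_xxxx)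
  finally show ?thesis by simp
qed simp

theorem theorem4p11:
  shows "(\<forall>G :: 'a pair_pre_digraph. connected_cograph G \<longrightarrow>
            int (mutual_visibility_number G) \<ge> int (card (pverts G)) - 2) \<and>
         poly_time_solvable
           {G. connected_cograph G \<and> (\<exists>n. pverts G = {..<n})}
           adjacency_matrix
           (\<lambda>G y. \<exists>P. y = characteristic_vector G P \<and> mutual_visibility_set G P \<and>
                   card P = mutual_visibility_number G)"
proof (intro conjI allI impI)
  fix G :: "'a pair_pre_digraph"
  assume "connected_cograph G"
  then interpret cograph G by (rule connected_cograph_imp_cograph)
  show "int (mutual_visibility_number G) \<ge> int (card (pverts G)) - 2"
    using mutual_visibility_number_ge by linarith
next
  show "poly_time_solvable
           {G. connected_cograph G \<and> (\<exists>n. pverts G = {..<n})}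
           adjacency_matrix
           (\<lambda>G y. \<exists>P. y = characteristic_vector G P \<and> mutual_visibility_set G P \<and>
                   card P = mutual_visibility_number G)"
    unfolding poly_time_solvable_def
  \<comment> \<open>Here \<open>1920 = 120 * 16\<close>, from the time bound of the program and
    \<open>Suc_power4_le\<close>.\<close>
  proof (rule exI[of _ max_visibility_prog], rule exI[of _ 1920], rule exI[of _ 2], rule ballI)
    fix G :: "nat pair_pre_digraph"
    assume "G \<in> {G. connected_cograph G \<and> (\<exists>n. pverts G = {..<n})}"
    then obtain n where G: "connected_cograph G" "pverts G = {..<n}" by blast
    interpret cograph G by (rule connected_cograph_imp_cograph) (rule G)
    have len: "length (adjacency_matrix G) = n * n"
      by (rule adjacency_matrix_state(1)[OF pair_wf_digraph G(2)])
    have "120 * (Suc n)^4 \<le> 1920 * length (adjacency_matrix G) ^ 2 + 1920"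
      using mult_le_mono2[OF Suc_power4_le[of n], of 120] unfolding len by simp
    moreover obtain t s P where "exec max_visibility_prog (input_state (adjacency_matrix G)) t s"
      "t \<le> 120 * (Suc n)^4" "is_output s (characteristic_vector G P)"
      "mutual_visibility_set G P" "card P = mutual_visibility_number G"
      using max_visibility_prog_correct[OF G] by blast
    ultimately show "\<exists>t s y. exec max_visibility_prog (input_state (adjacency_matrix G)) t s \<and>
        t \<le> 1920 * length (adjacency_matrix G) ^ 2 + 1920 \<and> is_output s y \<and>
        (\<exists>P. y = characteristic_vector G P \<and> mutual_visibility_set G P \<and>
          card P = mutual_visibility_number G)"
      by (intro exI[of _ t] exI[of _ s] exI[of _ "characteristic_vector G P"]) auto
  qed
qed

end
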